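(* Let $\mathcal{C}$ be an $[n,k,d]_q$ MDS code of distance $d\ge 3$ and covering radius $R=d-1$. Then for every farthest-off vector (deep hole) of $\mathcal{C}$ there are exactly $\binom{n}{d-1}$ codewords of $\mathcal{C}$ at distance $R$ from it; i.e. $\mathcal{C}$ is a $(d-1,\mu)$-APMCF code with $\mu=\binom{n}{d-1}$.
   Context: An $[n,k,d]_q$ code is a $k$-dimensional $\mathbb{F}_q$-linear subspace of $\mathbb{F}_q^n$ with minimum Hamming distance $d$; it is MDS if $d=n-k+1$. The covering radius of $\mathcal{C}$ is the least integer $R$ such that every $\mathbf{x}\in\mathbb{F}_q^n$ satisfies $d(\mathbf{x},\mathcal{C})\le R$, where $d(\mathbf{x},\mathcal{C})$ is the minimum Hamming distance from $\mathbf{x}$ to a codeword. A farthest-off vector (deep hole) is an $\mathbf{x}\in\mathbb{F}_q^n$ with $d(\mathbf{x},\mathcal{C})=R$. A code of covering radius $R$ is an $(R,\mu)$ almost perfect multiple covering of the farthest-off points ($(R,\mu)$-APMCF code) if for every $\mathbf{x}\in\mathbb{F}_q^n$ with $d(\mathbf{x},\mathcal{C})=R$ the number of codewords at Hamming distance exactly $R$ from $\mathbf{x}$ equals $\mu$. *)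

theory Defs
  imports "HOL-Analysis.Cartesian_Space"
begin

text \<open>Words of length \<open>n = CARD('n)\<close> over the alphabet \<open>F\<^sub>q\<close> are vectors of type
  \<open>'a ^ 'n\<close>, where \<open>'a\<close> is a finite field type with \<open>q = CARD('a)\<close>.\<close>

definition hamming_dist :: "'a ^ 'n \<Rightarrow> 'a ^ 'n \<Rightarrow> nat" where
  "hamming_dist x y = card {i. x $ i \<noteq> y $ i}"

text \<open>Relational, so that a code with fewer than two codewords has no minimum distance.\<close>

definition has_min_dist :: "('a ^ 'n) set \<Rightarrow> nat \<Rightarrow> bool" where
  "has_min_dist C d \<longleftrightarrow>
     (\<exists>x\<in>C. \<exists>y\<in>C. x \<noteq> y \<and> hamming_dist x y = d) \<and>
     (\<forall>x\<in>C. \<forall>y\<in>C. x \<noteq> y \<longrightarrow> d \<le> hamming_dist x y)"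

definition linear_code ::
    "nat \<Rightarrow> nat \<Rightarrow> nat \<Rightarrow> nat \<Rightarrow> ('a :: {field, finite} ^ 'n) set \<Rightarrow> bool" where
  "linear_code q n k d C \<longleftrightarrow>
     q = CARD('a) \<and> n = CARD('n) \<and>
     vec.subspace C \<and> vec.dim C = k \<and> has_min_dist C d"

text \<open>No truncation occurs in \<open>n - k\<close>: a subspace has dimension \<open>k \<le> n\<close>.\<close>

definition MDS_code ::
    "nat \<Rightarrow> nat \<Rightarrow> nat \<Rightarrow> nat \<Rightarrow> ('a :: {field, finite} ^ 'n) set \<Rightarrow> bool" where
  "MDS_code q n k d C \<longleftrightarrow> linear_code q n k d C \<and> d = n - k + 1"

definition dist_to_code :: "'a ^ 'n \<Rightarrow> ('a ^ 'n) set \<Rightarrow> nat" where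
  "dist_to_code x C = (INF c\<in>C. hamming_dist x c)"

definition covering_radius :: "('a ^ 'n) set \<Rightarrow> nat" where
  "covering_radius C = (LEAST R. \<forall>x. dist_to_code x C \<le> R)"

definition deep_hole :: "('a ^ 'n) set \<Rightarrow> 'a ^ 'n \<Rightarrow> bool" where
  "deep_hole C x \<longleftrightarrow> dist_to_code x C = covering_radius C"

definition APMCF :: "nat \<Rightarrow> nat \<Rightarrow> ('a ^ 'n) set \<Rightarrow> bool" where
  "APMCF R \<mu> C \<longleftrightarrow>
     covering_radius C = R \<and>
     (\<forall>x. dist_to_code x C = R \<longrightarrow> card {c \<in> C. hamming_dist x c = R} = \<mu>)"

end

theory Submission
  imports Defs
begin

text \<open>The key point is that any \<open>k\<close> coordinates of an MDS code form an information set: for each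
  set \<open>T\<close> of \<open>k\<close> coordinates, exactly one codeword agrees with a given word \<open>x\<close> on \<open>T\<close>. If \<open>x\<close> is at
  distance \<open>n - k\<close> from the code, that codeword must differ from \<open>x\<close> everywhere off \<open>T\<close>. Hence the
  codewords at distance \<open>n - k\<close> from \<open>x\<close> correspond to the \<open>(n - k)\<close>-subsets of the coordinates.\<close>

lemma hamming_dist_le_card:
  assumes "\<And>i. i \<notin> S \<Longrightarrow> x $ i = y $ i"
  shows "hamming_dist x y \<le> card S"
  unfolding hamming_dist_def using assms by (intro card_mono) auto

lemma dist_to_code_le:
  assumes "c \<in> C"
  shows "dist_to_code x C \<le> hamming_dist x c"
  unfolding dist_to_code_def using assms by (intro cINF_lower) auto

lemma has_min_dist_eqI:
  assumes "has_min_dist C d" and "x \<in> C" "y \<in> C"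
    and "\<And>i. i \<notin> S \<Longrightarrow> x $ i = y $ i" and "card S < d"
  shows "x = y"
  using assms hamming_dist_le_card[of S x y] unfolding has_min_dist_def by fastforce

text \<open>Restriction to \<open>T\<close> has trivial kernel on \<open>C\<close> by
  \<open>inj\<close>, so it preserves dimension; as \<open>C\<close> has dimension
  \<open>card T\<close>, its image is everything supported on \<open>T\<close>.\<close>

lemma information_set:
  fixes C :: "('a :: field ^ 'n) set"
  assumes sub: "vec.subspace C" and dim: "vec.dim C = card T"
    and inj: "\<And>c. c \<in> C \<Longrightarrow> (\<And>i. i \<in> T \<Longrightarrow> c $ i = 0) \<Longrightarrow> c = 0"
  obtains c where "c \<in> C" "\<And>i. i \<in> T \<Longrightarrow> c $ i = x $ i"
proof -
  \<comment> \<open>Zeroing the coordinates off \<open>T\<close> keeps the restriction inside the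
    same space, so that image and target \<open>?V\<close> are comparable subspaces.\<close>
  define P :: "'a ^ 'n \<Rightarrow> 'a ^ 'n" where "P v = (\<chi> i. if i \<in> T then v $ i else 0)" for v
  let ?V = "{v :: 'a ^ 'n. \<forall>i. i \<notin> T \<longrightarrow> v $ i = 0}"
  interpret P: Vector_Spaces.linear "(*s)" "(*s)" P
    by unfold_locales (auto simp: P_def vec_eq_iff vector_space_over_itself.scale_right_distrib)
  have "inj_on P C"
    unfolding P.inj_on_iff_eq_0[OF sub]
  proof (intro ballI impI)
    fix c assume "c \<in> C" "P c = 0"
    moreover from \<open>P c = 0\<close> have "c $ i = 0" if "i \<in> T" for i
      using that by (simp add: P_def vec_eq_iff split: if_splits)
    ultimately show "c = 0" using inj by blast
  qed
  moreover have "vec.span C = C" using sub by simp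
  ultimately have "vec.dim (P ` C) = card T"
    using vec.dim_image_eq[OF P.linear_axioms, of C] dim by metis
  moreover have "vec.dim ?V = card T" by (rule dim_substandard_cart)
  moreover have "vec.subspace (P ` C)" by (rule P.subspace_image[OF sub])
  moreover have "vec.subspace ?V" by (auto simp: vec.subspace_def)
  moreover have "P ` C \<subseteq> ?V" by (auto simp: P_def)
  ultimately have "P ` C = ?V" by (intro vec.subspace_dim_equal) auto
  moreover have "P x \<in> ?V" by (simp add: P_def)
  ultimately obtain c where c: "c \<in> C" "P c = P x" by (metis (lifting) imageE)
  show thesis
  proof (rule that[OF c(1)])
    fix i assume "i \<in> T"
    then show "c $ i = x $ i" using arg_cong[OF c(2), of "\<lambda>v. v $ i"] by (simp add: P_def)
  qed
qed

lemma MDS_card_codewords_at_redundancy: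
  fixes C :: "('a :: {field, finite} ^ 'n) set"
  assumes mds: "MDS_code q n k d C" and dist: "dist_to_code x C = d - 1"
  shows "card {c \<in> C. hamming_dist x c = d - 1} = n choose (d - 1)"
proof -
  from mds have n: "n = CARD('n)" and sub: "vec.subspace C" and dim: "vec.dim C = k"
    and md: "has_min_dist C d" and d: "d = n - k + 1"
    by (auto simp: MDS_code_def linear_code_def)
  \<comment> \<open>Makes \<open>n - k\<close> a true difference, so that a set of size
    \<open>d - 1\<close> has a complement of size exactly \<open>k\<close>.\<close>
  have "k \<le> n" using dim_subset_UNIV_cart_gen[of C] by (simp add: n dim)
  let ?D = "\<lambda>c. {i. x $ i \<noteq> c $ i}"
  have "bij_betw ?D {c \<in> C. hamming_dist x c = d - 1} {S. S \<subseteq> UNIV \<and> card S = d - 1}"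
    unfolding bij_betw_def
  proof (intro conjI inj_onI set_eqI iffI)
    fix c c' assume c: "c \<in> {c \<in> C. hamming_dist x c = d - 1}"
      and c': "c' \<in> {c \<in> C. hamming_dist x c = d - 1}" and eq: "?D c = ?D c'"
    show "c = c'"
    \<comment> \<open>Both codewords agree with \<open>x\<close>, hence with each other, off a
      common set of only \<open>d - 1\<close> coordinates.\<close>
    proof (rule has_min_dist_eqI[OF md])
      fix i assume i: "i \<notin> ?D c"
      then have "i \<notin> ?D c'" unfolding eq .
      with i show "c $ i = c' $ i" by simp
    qed (use c c' d in \<open>simp_all add: hamming_dist_def\<close>)
  next
    fix S assume "S \<in> ?D ` {c \<in> C. hamming_dist x c = d - 1}"
    then show "S \<in> {S. S \<subseteq> UNIV \<and> card S = d - 1}" by (auto simp: hamming_dist_def)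
  next
    fix S :: "'n set" assume "S \<in> {S. S \<subseteq> UNIV \<and> card S = d - 1}"
    then have S: "card S = d - 1" by simp
    have "card (- S) = k" using S d \<open>k \<le> n\<close> by (simp add: Compl_eq_Diff_UNIV card_Diff_subset n)
    \<comment> \<open>Such a \<open>c\<close> has weight at most \<open>d - 1\<close>, too close to
      the codeword 0 to differ from it.\<close>
    moreover have "c = 0" if "c \<in> C" "\<And>i. i \<in> - S \<Longrightarrow> c $ i = 0" for c
      using that S d vec.subspace_0[OF sub] by (intro has_min_dist_eqI[OF md, of _ _ S]) auto
    ultimately obtain c where c: "c \<in> C" "\<And>i. i \<in> - S \<Longrightarrow> c $ i = x $ i"
      using information_set[OF sub, of "- S" x] dim by metis
    have "?D c \<subseteq> S" using c(2) by force
    \<comment> \<open>No codeword is closer to \<open>x\<close> than \<open>d - 1\<close>, so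
      \<open>c\<close> must differ from \<open>x\<close> on all of \<open>S\<close>.\<close>
    moreover have "card S \<le> card (?D c)"
      using dist_to_code_le[OF c(1), of x] dist S by (simp add: hamming_dist_def)
    ultimately have "?D c = S" by (intro card_seteq) auto
    with S c(1) show "S \<in> ?D ` {c \<in> C. hamming_dist x c = d - 1}"
      by (auto simp: hamming_dist_def)
  qed
  then show ?thesis
    by (simp only: bij_betw_same_card n_subsets[OF finite] n)
qed

theorem theorem7p7:
  fixes C :: "('a :: {field, finite} ^ 'n) set" and q n k d R :: nat
  assumes "MDS_code q n k d C"
    and "d \<ge> 3"
    and "covering_radius C = R"
    and "R = d - 1"
  shows "(\<forall>x. deep_hole C x \<longrightarrow> card {c \<in> C. hamming_dist x c = R} = n choose (d - 1)) \<and>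
         APMCF (d - 1) (n choose (d - 1)) C"
  using assms MDS_card_codewords_at_redundancy[OF assms(1)]
  by (simp add: deep_hole_def APMCF_def)

end
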